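(* Let $(G,r)$ be a connected locally finite network such that for every edge $e\in E(G)$ there are infinitely many edge-disjoint barricades $S_1,S_2,\dots$ around $e$ with $\sum_{n=1}^\infty 1/\mathbf{wRD}(S_n)=\infty$. Then every non-elusive harmonic function of finite energy on $(G,r)$ is constant.
   Context: A network is a pair $(G,r)$ where $G$ is an undirected multigraph and $r:E(G)\to\mathbb{R}_{>0}$ assigns a resistance to every edge; $c(e)=1/r(e)$ is the conductance. It is locally finite if every vertex of $G$ is incident with only finitely many edges. A potential is a function $h:V(G)\to\mathbb{R}$; its energy is $\sum_{e=vw\in E(G)} (h(v)-h(w))^2/r(e)$. A potential $h$ is harmonic if for every vertex $v$ the value $h(v)$ is the average of the values of $h$ at its neighbours weighted by conductances, i.e. $\sum_{e=vw}c(e)(h(v)-h(w))=0$ (sum over edges $e$ incident with $v$). A harmonic function $h$ is non-elusive if for every finite cut, i.e. every bipartition $(X,X')$ of $V(G)$ with only finitely many edges between $X$ and $X'$, one has $\sum_{e=vw,\ v\in X,\ w\in X'}\frac{h(v)-h(w)}{r(e)}=0$. For a subgraph $S$ of $G$, $G-S$ denotes $G$ with all vertices of $S$ deleted. A subgraph $S$ of $G$ is a barricade around the edge $e\in E(G-S)$ if (1) the component of $G-S$ containing $e$ is finite; this component is called the barricaded area $A(S,e)$; and (2) the intersection of $S$ with any component of $G-A(S,e)$ is connected. The boundary $\partial S$ of $S$ is the neighbourhood of $A(S,e)$ (the set of vertices outside $A(S,e)$ having a neighbour in it). For a component $C$ of $S$ put $\partial C:=\partial S\cap C$. For a connected finite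 network $(H,r)$ and vertices $x,y$, $R(x\leftrightarrow y;H)$ is the effective resistance between $x$ and $y$: the potential difference $h(x)-h(y)$ of a potential $h$ on $H$ that induces, via $\vec e\mapsto (h(init(\vec e))-h(ter(\vec e)))/r(e)$, a flow of intensity $1$ from $x$ to $y$ (and $0$ if $x=y$). For a component $C$ of a barricade, $\mathbf{wRD}(C):=\sup\{R(x\leftrightarrow y;C)\mid x,y\in\partial C\}$, with resistances restricted from $r$; for a barricade $S$, $\mathbf{wRD}(S)$ is the sum of $\mathbf{wRD}(C)$ over all components $C$ of $S$. Barricades in the statement are finite subgraphs, and $1/0$ is read as $\infty$. *)

theory Defs
  imports "HOL-Analysis.Analysis"
begin

section \<open>Undirected multigraphs\<close>

text \<open>Parallel edges are distinct elements of \<open>edges\<close> with the same set of ends; a loop has a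
  singleton as its set of ends.\<close>

record ('v, 'e) multigraph =
  verts :: "'v set"
  edges :: "'e set"
  ends :: "'e \<Rightarrow> 'v set"

definition wf_graph :: "('v, 'e) multigraph \<Rightarrow> bool" where
  "wf_graph G \<longleftrightarrow> (\<forall>e\<in>edges G. \<exists>v\<in>verts G. \<exists>w\<in>verts G. ends G e = {v, w})"

definition adjacent :: "('v, 'e) multigraph \<Rightarrow> 'v \<Rightarrow> 'v \<Rightarrow> bool" where
  "adjacent G v w \<longleftrightarrow> (\<exists>e\<in>edges G. ends G e = {v, w})"

definition connected_graph :: "('v, 'e) multigraph \<Rightarrow> bool" where
  "connected_graph G \<longleftrightarrow>
     verts G \<noteq> {} \<and> (\<forall>v\<in>verts G. \<forall>w\<in>verts G. (adjacent G)\<^sup>*\<^sup>* v w)"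

definition locally_finite_graph :: "('v, 'e) multigraph \<Rightarrow> bool" where
  "locally_finite_graph G \<longleftrightarrow> (\<forall>v\<in>verts G. finite {e \<in> edges G. v \<in> ends G e})"

definition finite_graph :: "('v, 'e) multigraph \<Rightarrow> bool" where
  "finite_graph G \<longleftrightarrow> finite (verts G) \<and> finite (edges G)"

text \<open>The functions \<open>ends\<close> are required to agree also outside \<open>edges S\<close>, so that a subgraph is
  determined by its vertices and edges.\<close>

definition subgraph_of :: "('v, 'e) multigraph \<Rightarrow> ('v, 'e) multigraph \<Rightarrow> bool" where
  "subgraph_of S G \<longleftrightarrow>
     wf_graph S \<and> verts S \<subseteq> verts G \<and> edges S \<subseteq> edges G \<and> ends S = ends G"

definition induced :: "('v, 'e) multigraph \<Rightarrow> 'v set \<Rightarrow> ('v, 'e) multigraph" where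
  "induced G X =
     \<lparr>verts = verts G \<inter> X, edges = {e \<in> edges G. ends G e \<subseteq> X}, ends = ends G\<rparr>"

definition delete_verts :: "('v, 'e) multigraph \<Rightarrow> ('v, 'e) multigraph \<Rightarrow> ('v, 'e) multigraph"
  where "delete_verts G S = induced G (verts G - verts S)"

text \<open>Both arguments are meant to be subgraphs of one graph, so they share the function \<open>ends\<close>.\<close>

definition graph_inter :: "('v, 'e) multigraph \<Rightarrow> ('v, 'e) multigraph \<Rightarrow> ('v, 'e) multigraph"
  where "graph_inter S D =
     \<lparr>verts = verts S \<inter> verts D, edges = edges S \<inter> edges D, ends = ends S\<rparr>"

definition components_of :: "('v, 'e) multigraph \<Rightarrow> ('v, 'e) multigraph set" where
  "components_of G = (\<lambda>v. induced G {w. (adjacent G)\<^sup>*\<^sup>* v w}) ` verts G"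


section \<open>Networks, potentials and effective resistance\<close>

definition network :: "('v, 'e) multigraph \<Rightarrow> ('e \<Rightarrow> real) \<Rightarrow> bool" where
  "network G r \<longleftrightarrow> wf_graph G \<and> (\<forall>e\<in>edges G. 0 < r e)"

text \<open>The definite description is legitimate, as the term is symmetric in the two ends of \<open>e\<close>.\<close>

definition edge_energy ::
    "('v, 'e) multigraph \<Rightarrow> ('e \<Rightarrow> real) \<Rightarrow> ('v \<Rightarrow> real) \<Rightarrow> 'e \<Rightarrow> real" where
  "edge_energy G r h e = (THE q. \<exists>v w. ends G e = {v, w} \<and> q = (h v - h w)\<^sup>2 / r e)"

definition energy :: "('v, 'e) multigraph \<Rightarrow> ('e \<Rightarrow> real) \<Rightarrow> ('v \<Rightarrow> real) \<Rightarrow> ennreal" where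
  "energy G r h = (\<Sum>\<^sub>\<infinity>e\<in>edges G. ennreal (edge_energy G r h e))"

definition directed_edges_between ::
    "('v, 'e) multigraph \<Rightarrow> 'v set \<Rightarrow> 'v set \<Rightarrow> ('v \<times> 'e \<times> 'v) set" where
  "directed_edges_between G X Y =
     {(v, e, w). e \<in> edges G \<and> ends G e = {v, w} \<and> v \<in> X \<and> w \<in> Y}"

text \<open>The flow from \<open>X\<close> to \<open>Y\<close> induced by the potential \<open>h\<close>; only meaningful if there are finitely
  many edges between \<open>X\<close> and \<open>Y\<close>.\<close>

definition flow_between ::
    "('v, 'e) multigraph \<Rightarrow> ('e \<Rightarrow> real) \<Rightarrow> ('v \<Rightarrow> real) \<Rightarrow> 'v set \<Rightarrow> 'v set \<Rightarrow> real" where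
  "flow_between G r h X Y = (\<Sum>(v, e, w)\<in>directed_edges_between G X Y. (h v - h w) / r e)"

text \<open>The net flow out of \<open>v\<close>, i.e. the sum over the edges incident with \<open>v\<close>; loops contribute 0.\<close>

definition net_outflow ::
    "('v, 'e) multigraph \<Rightarrow> ('e \<Rightarrow> real) \<Rightarrow> ('v \<Rightarrow> real) \<Rightarrow> 'v \<Rightarrow> real" where
  "net_outflow G r h v = flow_between G r h {v} (verts G)"

definition harmonic :: "('v, 'e) multigraph \<Rightarrow> ('e \<Rightarrow> real) \<Rightarrow> ('v \<Rightarrow> real) \<Rightarrow> bool" where
  "harmonic G r h \<longleftrightarrow> (\<forall>v\<in>verts G. net_outflow G r h v = 0)"

definition non_elusive :: "('v, 'e) multigraph \<Rightarrow> ('e \<Rightarrow> real) \<Rightarrow> ('v \<Rightarrow> real) \<Rightarrow> bool" where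
  "non_elusive G r h \<longleftrightarrow>
     (\<forall>X X'. X \<union> X' = verts G \<and> X \<inter> X' = {} \<and>
        finite {e \<in> edges G. \<exists>v\<in>X. \<exists>w\<in>X'. ends G e = {v, w}} \<longrightarrow>
        flow_between G r h X X' = 0)"

definition induces_unit_flow ::
    "('v, 'e) multigraph \<Rightarrow> ('e \<Rightarrow> real) \<Rightarrow> ('v \<Rightarrow> real) \<Rightarrow> 'v \<Rightarrow> 'v \<Rightarrow> bool" where
  "induces_unit_flow H r h x y \<longleftrightarrow>
     (\<forall>v\<in>verts H. net_outflow H r h v = (if v = x then 1 else if v = y then - 1 else 0))"

text \<open>Intended for vertices of a finite connected network, where the potential
  difference exists and is unique.\<close>

definition eff_resistance ::
    "('v, 'e) multigraph \<Rightarrow> ('e \<Rightarrow> real) \<Rightarrow> 'v \<Rightarrow> 'v \<Rightarrow> real" where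
  "eff_resistance H r x y =
     (if x = y then 0 else (THE \<rho>. \<exists>h. induces_unit_flow H r h x y \<and> \<rho> = h x - h y))"


section \<open>Barricades\<close>

definition barricaded_area ::
    "('v, 'e) multigraph \<Rightarrow> ('v, 'e) multigraph \<Rightarrow> 'e \<Rightarrow> ('v, 'e) multigraph" where
  "barricaded_area G S e = (THE K. K \<in> components_of (delete_verts G S) \<and> e \<in> edges K)"

definition barricade ::
    "('v, 'e) multigraph \<Rightarrow> ('v, 'e) multigraph \<Rightarrow> 'e \<Rightarrow> bool" where
  "barricade G S e \<longleftrightarrow>
     subgraph_of S G \<and> finite_graph S \<and> e \<in> edges (delete_verts G S) \<and>
     finite_graph (barricaded_area G S e) \<and>
     (\<forall>D\<in>components_of (delete_verts G (barricaded_area G S e)).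
        connected_graph (graph_inter S D))"

definition barricade_boundary ::
    "('v, 'e) multigraph \<Rightarrow> ('v, 'e) multigraph \<Rightarrow> 'e \<Rightarrow> 'v set" where
  "barricade_boundary G S e =
     {u \<in> verts G - verts (barricaded_area G S e).
        \<exists>w\<in>verts (barricaded_area G S e). adjacent G u w}"

text \<open>Values are extended nonnegative reals, where \<open>1 / 0 = \<infinity>\<close> (and the supremum of the empty set
  is 0).\<close>

definition wRD_component ::
    "('v, 'e) multigraph \<Rightarrow> ('e \<Rightarrow> real) \<Rightarrow> 'v set \<Rightarrow> ennreal" where
  "wRD_component C r B = Sup {ennreal (eff_resistance C r x y) | x y. x \<in> B \<and> y \<in> B}"

definition wRD ::
    "('v, 'e) multigraph \<Rightarrow> ('e \<Rightarrow> real) \<Rightarrow> ('v, 'e) multigraph \<Rightarrow> 'e \<Rightarrow> ennreal" where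
  "wRD G r S e =
     (\<Sum>C\<in>components_of S. wRD_component C r (barricade_boundary G S e \<inter> verts C))"

end

theory Submission
  imports Defs
begin

text \<open>By non-elusiveness, the drop of \<open>h\<close> along \<open>e\<close> is at most the sum, over the components
  \<open>C\<close> of a barricade around \<open>e\<close>, of the oscillation of \<open>h\<close> on the boundary of \<open>C\<close>: otherwise
  some level set of \<open>h\<close> would give a finite cut carrying a positive flow. By the Cauchy-Schwarz
  inequality against unit flows, each oscillation is at most the square root of \<open>wRD C\<close> times the
  energy of \<open>h\<close> on \<open>C\<close>, so the energy of \<open>h\<close> on the barricade is at least the squared drop
  divided by \<open>wRD S\<close>. Summed over disjoint barricades, a non-zero drop forces infinite
  energy.\<close>

section \<open>Connectivity\<close>

lemma adjacent_commute: "adjacent G v w \<longleftrightarrow> adjacent G w v"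
  unfolding adjacent_def by (simp add: insert_commute)

lemma reachable_sym: "(adjacent G)\<^sup>*\<^sup>* v w \<Longrightarrow> (adjacent G)\<^sup>*\<^sup>* w v"
proof (induction rule: rtranclp_induct)
  case (step y z)
  then show ?case
    using adjacent_commute[of G y z] by (blast intro: converse_rtranclp_into_rtranclp)
qed simp

lemma wf_adjacentD: "wf_graph G \<Longrightarrow> adjacent G v w \<Longrightarrow> v \<in> verts G \<and> w \<in> verts G"
  unfolding wf_graph_def adjacent_def by (metis doubleton_eq_iff)

lemma wf_graphD:
  assumes "wf_graph G" "e \<in> edges G" "ends G e = {v, w}"
  shows "v \<in> verts G" "w \<in> verts G"
  using assms wf_adjacentD[of G v w] unfolding adjacent_def by auto

lemma wf_induced: "wf_graph G \<Longrightarrow> wf_graph (induced G X)"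
  unfolding wf_graph_def induced_def by fastforce

lemma adjacent_induced:
  "adjacent (induced G X) v w \<longleftrightarrow> adjacent G v w \<and> v \<in> X \<and> w \<in> X"
  unfolding adjacent_def induced_def by auto

text \<open>A walk starting at \<open>v\<close> visits only vertices reachable from
  \<open>v\<close>, so it survives in the induced subgraph.\<close>

lemma reachable_in_component:
  assumes "(adjacent G)\<^sup>*\<^sup>* v w"
  shows "(adjacent (induced G {u. (adjacent G)\<^sup>*\<^sup>* v u}))\<^sup>*\<^sup>* v w"
  using assms
proof (induction rule: rtranclp_induct)
  case (step y z)
  then have "adjacent (induced G {u. (adjacent G)\<^sup>*\<^sup>* v u}) y z"
    by (auto simp: adjacent_induced intro: rtranclp.rtrancl_into_rtrancl)
  then show ?case using step.IH by (rule rtranclp.rtrancl_into_rtrancl[rotated])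
qed simp

lemma connected_component:
  assumes "C \<in> components_of G"
  shows "connected_graph C"
proof -
  obtain v where v: "v \<in> verts G" and C: "C = induced G {w. (adjacent G)\<^sup>*\<^sup>* v w}"
    using assms unfolding components_of_def by auto
  have "v \<in> verts C" using v C by (simp add: induced_def)
  moreover have "(adjacent C)\<^sup>*\<^sup>* x y" if "x \<in> verts C" "y \<in> verts C" for x y
  proof -
    have "(adjacent C)\<^sup>*\<^sup>* v x" "(adjacent C)\<^sup>*\<^sup>* v y"
      using that reachable_in_component[of G v] unfolding C by (auto simp: induced_def)
    then show ?thesis using reachable_sym rtranclp_trans by metis
  qed
  ultimately show ?thesis unfolding connected_graph_def by blast
qed

lemma component_eqI:
  assumes "(adjacent G)\<^sup>*\<^sup>* u v"
  shows "induced G {w. (adjacent G)\<^sup>*\<^sup>* u w} = induced G {w. (adjacent G)\<^sup>*\<^sup>* v w}"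
proof -
  have "{w. (adjacent G)\<^sup>*\<^sup>* u w} = {w. (adjacent G)\<^sup>*\<^sup>* v w}"
    using assms reachable_sym rtranclp_trans by (metis (no_types, lifting))
  then show ?thesis by simp
qed

text \<open>Reachability is an equivalence relation, so any vertex of a component may serve as its
  base point.\<close>

lemma component_eq:
  assumes "C \<in> components_of G" "v \<in> verts C"
  shows "C = induced G {w. (adjacent G)\<^sup>*\<^sup>* v w}"
proof -
  obtain u where C: "C = induced G {w. (adjacent G)\<^sup>*\<^sup>* u w}"
    using assms(1) unfolding components_of_def by blast
  then have "(adjacent G)\<^sup>*\<^sup>* u v" using assms(2) by (simp add: induced_def)
  then show ?thesis unfolding C by (rule component_eqI)
qed

lemma component_subgraph:
  assumes "C \<in> components_of G"
  shows "verts C \<subseteq> verts G" "edges C \<subseteq> edges G" "ends C = ends G"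
  using assms unfolding components_of_def induced_def by auto

lemma wf_component: "wf_graph G \<Longrightarrow> C \<in> components_of G \<Longrightarrow> wf_graph C"
  unfolding components_of_def by (auto intro: wf_induced)

lemma finite_component:
  assumes "finite_graph G" "C \<in> components_of G"
  shows "finite_graph C"
  using assms component_subgraph[of C G] unfolding finite_graph_def
  by (meson finite_subset)

text \<open>A common edge has an end in both components, and one vertex determines its component.
  This makes the barricaded area unique and lets energies of components add up.\<close>

lemma component_edges_disjoint:
  assumes "wf_graph G" "C \<in> components_of G" "D \<in> components_of G" "C \<noteq> D"
  shows "edges C \<inter> edges D = {}"
proof (rule ccontr)
  assume "edges C \<inter> edges D \<noteq> {}"
  then obtain e where e: "e \<in> edges C" "e \<in> edges D" by auto
  obtain v w where v: "v \<in> verts C" "ends C e = {v, w}"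
    using wf_component[OF assms(1,2)] e(1) unfolding wf_graph_def by blast
  have "ends D e = {v, w}"
    using v(2) component_subgraph(3)[OF assms(2)] component_subgraph(3)[OF assms(3)] by simp
  then have "v \<in> verts D"
    using wf_graphD(1)[OF wf_component[OF assms(1,3)] e(2)] by blast
  then have "C = D"
    by (rule trans[OF component_eq[OF assms(2) v(1)] component_eq[OF assms(3), symmetric]])
  with assms(4) show False ..
qed

section \<open>Finite networks\<close>

abbreviation arcs :: "('v, 'e) multigraph \<Rightarrow> ('v \<times> 'e \<times> 'v) set" where
  "arcs H \<equiv> directed_edges_between H (verts H) (verts H)"

text \<open>Every edge that is not a loop is counted twice here, so \<open>dirichlet H r h h\<close> is twice the
  energy.\<close>

definition dirichlet ::
    "('v, 'e) multigraph \<Rightarrow> ('e \<Rightarrow> real) \<Rightarrow> ('v \<Rightarrow> real) \<Rightarrow> ('v \<Rightarrow> real) \<Rightarrow> real" where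
  "dirichlet H r f g = (\<Sum>(v, e, w)\<in>arcs H. (f v - f w) * (g v - g w) / r e)"

lemma edge_energy_eq:
  assumes "ends G e = {v, w}"
  shows "edge_energy G r h e = (h v - h w)\<^sup>2 / r e"
  unfolding edge_energy_def
proof (rule the_equality)
  show "\<exists>v' w'. ends G e = {v', w'} \<and> (h v - h w)\<^sup>2 / r e = (h v' - h w')\<^sup>2 / r e"
    using assms by blast
  fix q assume "\<exists>v w. ends G e = {v, w} \<and> q = (h v - h w)\<^sup>2 / r e"
  then show "q = (h v - h w)\<^sup>2 / r e"
    using assms by (auto simp: doubleton_eq_iff power2_commute)
qed

lemma edge_energy_nonneg:
  assumes "network G r" "e \<in> edges G"
  shows "0 \<le> edge_energy G r h e"
proof -
  obtain v w where "ends G e = {v, w}"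
    using assms unfolding network_def wf_graph_def by blast
  then show ?thesis
    using assms edge_energy_eq[of G e v w r h] unfolding network_def by (simp add: less_imp_le)
qed

lemma net_outflow_diff:
  "net_outflow H r (\<lambda>v. f v - g v) v = net_outflow H r f v - net_outflow H r g v"
  unfolding net_outflow_def flow_between_def sum_subtractf[symmetric]
  by (rule sum.cong) (auto simp: diff_divide_distrib)

lemma net_outflow_scale:
  "net_outflow H r (\<lambda>v. f v / c) v = net_outflow H r f v / c"
  unfolding net_outflow_def flow_between_def sum_divide_distrib
  by (rule sum.cong) (auto simp: diff_divide_distrib mult.commute)

locale finite_network =
  fixes H :: "('v, 'e) multigraph" and r :: "'e \<Rightarrow> real"
  assumes net: "network H r" and fin: "finite_graph H"
begin

lemma finite_arcs: "finite (directed_edges_between H X Y)"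
proof (rule finite_subset)
  show "directed_edges_between H X Y \<subseteq> verts H \<times> edges H \<times> verts H"
    using net wf_graphD unfolding directed_edges_between_def network_def by fast
  show "finite (verts H \<times> edges H \<times> verts H)"
    using fin unfolding finite_graph_def by simp
qed

text \<open>Reversal is an involution on arcs; loops are its fixed points.\<close>

lemma sum_arcs_swap:
  "(\<Sum>(v, e, w)\<in>arcs H. f v e w) = (\<Sum>(v, e, w)\<in>arcs H. (f w e v :: real))"
  by (rule sum.reindex_bij_witness[where i = "\<lambda>(v, e, w). (w, e, v)" and j = "\<lambda>(v, e, w). (w, e, v)"])
     (auto simp: directed_edges_between_def insert_commute)

lemma sum_net_outflow:
  "(\<Sum>v\<in>verts H. f v * net_outflow H r g v) = (\<Sum>(v, e, w)\<in>arcs H. f v * (g v - g w) / r e)"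
proof -
  have "arcs H = (\<Union>v\<in>verts H. directed_edges_between H {v} (verts H))"
    unfolding directed_edges_between_def by auto
  then have "(\<Sum>(v, e, w)\<in>arcs H. f v * (g v - g w) / r e) =
    (\<Sum>v\<in>verts H. \<Sum>(v, e, w)\<in>directed_edges_between H {v} (verts H). f v * (g v - g w) / r e)"
    using fin
    by (simp only:, intro sum.UNION_disjoint ballI finite_arcs)
       (auto simp: finite_graph_def directed_edges_between_def)
  also have "\<dots> = (\<Sum>v\<in>verts H. f v * net_outflow H r g v)"
    unfolding net_outflow_def flow_between_def sum_distrib_left
    by (intro sum.cong) (auto simp: directed_edges_between_def)
  finally show ?thesis by simp
qed

text \<open>Discrete Green formula: after splitting the factor \<open>f v - f w\<close>, reversing
  the arcs turns the second half into the first, and grouping by initial vertex produces the net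
  outflows.\<close>

lemma dirichlet_eq:
  "dirichlet H r f g = 2 * (\<Sum>v\<in>verts H. f v * net_outflow H r g v)"
proof -
  have "dirichlet H r f g = (\<Sum>(v, e, w)\<in>arcs H. f v * (g v - g w) / r e) +
      (\<Sum>(v, e, w)\<in>arcs H. f w * (g w - g v) / r e)"
    unfolding dirichlet_def sum.distrib[symmetric]
    by (intro sum.cong) (auto simp: field_simps diff_divide_distrib add_divide_distrib)
  also have "(\<Sum>(v, e, w)\<in>arcs H. f w * (g w - g v) / r e) =
      (\<Sum>(v, e, w)\<in>arcs H. f v * (g v - g w) / r e)"
    by (rule sum_arcs_swap)
  finally show ?thesis using sum_net_outflow[of f g] by simp
qed

lemma arc_resistance_pos: "(v, e, w) \<in> directed_edges_between H X Y \<Longrightarrow> 0 < r e"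
  using net unfolding network_def directed_edges_between_def by auto

lemma dirichlet_nonneg: "0 \<le> dirichlet H r f f"
  unfolding dirichlet_def by (intro sum_nonneg) (auto dest: arc_resistance_pos)

text \<open>Dividing differences by \<open>sqrt (r e)\<close> turns the form into a Euclidean inner
  product of vectors indexed by arcs.\<close>

lemma dirichlet_Cauchy_Schwarz:
  "(dirichlet H r f g)\<^sup>2 \<le> dirichlet H r f f * dirichlet H r g g"
proof -
  let ?d = "\<lambda>h (v, e, w). (h v - h w) / sqrt (r e)"
  have *: "dirichlet H r h k = (\<Sum>a\<in>arcs H. ?d h a * ?d k a)" for h k
    unfolding dirichlet_def by (intro sum.cong) (auto dest: arc_resistance_pos)
  show ?thesis
    using Cauchy_Schwarz_ineq_sum[of "?d f" "?d g" "arcs H"] unfolding * power2_eq_square .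
qed

text \<open>Each edge underlies at most two arcs, and only one if it is a loop; bounding this number
  treats both cases at once.\<close>

lemma dirichlet_le_energy:
  "dirichlet H r h h \<le> 2 * (\<Sum>e\<in>edges H. edge_energy H r h e)"
proof -
  let ?A = "\<lambda>e. {(v, w). v \<in> verts H \<and> w \<in> verts H \<and> ends H e = {v, w}}"
  have fA: "finite (?A e)" for e
    by (rule finite_subset[of _ "verts H \<times> verts H"]) (use fin in \<open>auto simp: finite_graph_def\<close>)
  have "dirichlet H r h h = (\<Sum>(e, v, w)\<in>Sigma (edges H) ?A. (h v - h w) * (h v - h w) / r e)"
    unfolding dirichlet_def
    by (rule sum.reindex_bij_witness[where i = "\<lambda>(e, v, w). (v, e, w)" and j = "\<lambda>(v, e, w). (e, v, w)"])
       (auto simp: directed_edges_between_def)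
  also have "\<dots> = (\<Sum>e\<in>edges H. \<Sum>(v, w)\<in>?A e. (h v - h w) * (h v - h w) / r e)"
    using fin fA by (subst sum.Sigma[symmetric]) (auto simp: finite_graph_def)
  also have "\<dots> \<le> (\<Sum>e\<in>edges H. 2 * edge_energy H r h e)"
  proof (rule sum_mono)
    fix e assume e: "e \<in> edges H"
    obtain a b where ab: "ends H e = {a, b}"
      using net e unfolding network_def wf_graph_def by blast
    have "(\<Sum>(v, w)\<in>?A e. (h v - h w) * (h v - h w) / r e) = (\<Sum>_\<in>?A e. edge_energy H r h e)"
      by (intro sum.cong) (auto simp: edge_energy_eq power2_eq_square)
    also have "\<dots> = card (?A e) * edge_energy H r h e" by simp
    also have "\<dots> \<le> 2 * edge_energy H r h e"
    proof (rule mult_right_mono)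
      have "(v, w) = (a, b) \<or> (v, w) = (b, a)" if "ends H e = {v, w}" for v w
        using that unfolding ab doubleton_eq_iff by blast
      then have "?A e \<subseteq> {(a, b), (b, a)}" by blast
      then have "card (?A e) \<le> card {(a, b), (b, a)}" by (intro card_mono) simp_all
      also have "\<dots> \<le> 2" by (simp add: card_insert_le_m1)
      finally show "real (card (?A e)) \<le> 2" by linarith
    qed (rule edge_energy_nonneg[OF net e])
    finally show "(\<Sum>(v, w)\<in>?A e. (h v - h w) * (h v - h w) / r e) \<le> 2 * edge_energy H r h e" .
  qed
  finally show ?thesis by (simp add: sum_distrib_left)
qed

text \<open>All summands are nonnegative, so each vanishes and \<open>h\<close> does not change
  along any edge.\<close>

lemma constant_if_dirichlet_zero:
  assumes "connected_graph H" "dirichlet H r h h = 0" "x \<in> verts H" "y \<in> verts H"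
  shows "h x = h y"
proof -
  have edge: "h v = h w" if "adjacent H v w" for v w
  proof -
    obtain e where e: "e \<in> edges H" "ends H e = {v, w}" using \<open>adjacent H v w\<close> unfolding adjacent_def by auto
    then have arc: "(v, e, w) \<in> arcs H"
      using net wf_graphD[OF _ e] unfolding directed_edges_between_def network_def by simp
    have "\<forall>a\<in>arcs H. (case a of (v, e, w) \<Rightarrow> (h v - h w) * (h v - h w) / r e) = 0"
      using assms(2) unfolding dirichlet_def
      by (subst (asm) sum_nonneg_eq_0_iff) (auto intro: finite_arcs dest: arc_resistance_pos)
    from bspec[OF this arc] have "(h v - h w) * (h v - h w) / r e = 0" by simp
    then show ?thesis using arc_resistance_pos[OF arc] by simp
  qed
  have "(adjacent H)\<^sup>*\<^sup>* x y" using assms unfolding connected_graph_def by blast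
  then show ?thesis by (induction rule: rtranclp_induct) (auto dest: edge)
qed

text \<open>Among the functions with values in \<open>[0, 1]\<close> that are 1 at \<open>x\<close> and 0 at \<open>y\<close>, one of minimal
  energy is harmonic elsewhere, since replacing its value at a vertex by the weighted average over
  the neighbours would decrease the energy.\<close>

lemma ex_harmonic_off:
  assumes "x \<noteq> y"
  shows "\<exists>h. h x = 1 \<and> h y = 0 \<and> (\<forall>v\<in>verts H - {x, y}. net_outflow H r h v = 0)"
proof -
  define I :: "'v \<Rightarrow> real set" where "I v = (if v = x then {1} else if v = y then {0} else {0..1})" for v
  define K where "K = PiE UNIV I"
  \<comment> \<open>Tychonoff: the constraints form a product of compact sets over the whole vertex
    type, which may be infinite.\<close>
  have "compactin (product_topology (\<lambda>_. euclidean) UNIV) K"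
    unfolding K_def by (subst compactin_PiE) (auto simp: I_def)
  then have "compact K" by (simp add: euclidean_product_topology)
  moreover have "(\<lambda>v. if v = x then 1 else 0) \<in> K"
    using assms by (auto simp: K_def I_def)
  moreover have "continuous_on K (\<lambda>h. dirichlet H r h h)"
    unfolding dirichlet_def case_prod_unfold
    by (intro continuous_intros continuous_on_subset[OF continuous_on_product_coordinates])
       (auto dest: arc_resistance_pos)
  ultimately obtain h where h: "h \<in> K"
    and min: "\<And>k. k \<in> K \<Longrightarrow> dirichlet H r h h \<le> dirichlet H r k k"
    using continuous_attains_inf[of K] by fastforce
  have hI: "h v \<in> I v" for v using h unfolding K_def by (rule PiE_mem) simp
  have bounds: "0 \<le> h v" "h v \<le> 1" for v
    using hI[of v] unfolding I_def by (auto split: if_splits)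
  have "h x = 1" "h y = 0" using hI[of x] hI[of y] assms unfolding I_def by simp_all
  moreover have "net_outflow H r h v = 0" if v: "v \<in> verts H - {x, y}" for v
  proof (rule ccontr)
    define m where "m = net_outflow H r h v"
    assume "net_outflow H r h v \<noteq> 0"
    then have m0: "m \<noteq> 0" by (simp add: m_def)
    \<comment> \<open>Loops at \<open>v\<close> carry no flow, and dropping them makes
      \<open>c\<close> the exact rate at which the outflow changes with the value at
      \<open>v\<close>.\<close>
    define D where "D = {(u, e, w) \<in> directed_edges_between H {v} (verts H). w \<noteq> v}"
    have fD: "finite D" by (rule finite_subset[OF _ finite_arcs]) (auto simp: D_def)
    have flow: "net_outflow H r f v = (\<Sum>(u, e, w)\<in>D. (f v - f w) / r e)" for f
      unfolding net_outflow_def flow_between_def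
      by (rule sum.mono_neutral_cong_right[OF finite_arcs])
         (auto simp: D_def directed_edges_between_def)
    define c where "c = (\<Sum>(u, e, w)\<in>D. 1 / r e)"
    define d where "d = (\<lambda>u. if u = v then 1 else 0 :: real)"
    have posD: "0 < r e" if "(u, e, w) \<in> D" for u e w
      using that arc_resistance_pos unfolding D_def by fast
    have "D \<noteq> {}" using m0 flow[of h] unfolding m_def by auto
    then have c0: "c > 0" unfolding c_def by (intro sum_pos fD) (auto dest: posD)
    have netd: "net_outflow H r d v = c"
      unfolding flow c_def d_def by (intro sum.cong) (auto simp: D_def)
    define s where "s = (\<Sum>(u, e, w)\<in>D. h w / r e)"
    have m: "m = c * h v - s"
      unfolding m_def flow c_def s_def sum_distrib_right sum_subtractf[symmetric]
      by (intro sum.cong) (auto simp: diff_divide_distrib)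
    have "0 \<le> s" unfolding s_def by (intro sum_nonneg) (auto intro!: divide_nonneg_pos bounds dest: posD)
    moreover have "s \<le> c" unfolding s_def c_def
      by (intro sum_mono) (auto intro!: divide_right_mono[OF bounds(2)] dest: posD)
    \<comment> \<open>The new value at \<open>v\<close> is the average of the neighbouring values
      weighted by conductance, so it stays in \<open>{0..1}\<close>.\<close>
    moreover have hs: "h v - m / c = s / c" using c0 m by (simp add: field_simps)
    ultimately have "h v - m / c \<in> {0..1}" using c0 by (simp add: hs)
    moreover have "I v = {0..1}" using v unfolding I_def by auto
    ultimately have mem: "h u - m / c * d u \<in> I u" for u
      using hI[of u] unfolding d_def by (cases "u = v") simp_all
    have dd: "dirichlet H r d f = 2 * net_outflow H r f v" for f
      using v fin unfolding dirichlet_eq d_def finite_graph_def by (simp add: if_distrib[of "\<lambda>a. a * _"] cong: if_cong)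
    have "(\<lambda>u. h u - m / c * d u) \<in> K" unfolding K_def by (intro PiE_I mem) simp
    from min[OF this] have "dirichlet H r h h \<le> dirichlet H r (\<lambda>u. h u - m / c * d u) (\<lambda>u. h u - m / c * d u)" .
    also have "\<dots> = dirichlet H r h h - 2 * (m / c) * dirichlet H r d h + (m / c)\<^sup>2 * dirichlet H r d d"
      unfolding dirichlet_def sum_distrib_left sum_subtractf[symmetric] sum.distrib[symmetric]
      by (intro sum.cong) (auto simp: algebra_simps power2_eq_square diff_divide_distrib add_divide_distrib)
    \<comment> \<open>By \<open>dd\<close>, the linear term is \<open>- 4 * m^2 / c\<close> and the
      quadratic term \<open>2 * m^2 / c\<close>, so the form strictly drops.\<close>
    also have "\<dots> = dirichlet H r h h - 2 * m\<^sup>2 / c"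
      using c0 unfolding dd netd m_def[symmetric] by (simp add: field_simps power2_eq_square)
    finally show False using c0 m0 by (simp add: field_simps)
  qed
  ultimately show ?thesis by blast
qed

section \<open>Unit flows and effective resistance\<close>

lemma ex_unit_flow:
  assumes "connected_graph H" "x \<in> verts H" "y \<in> verts H" "x \<noteq> y"
  shows "\<exists>h. induces_unit_flow H r h x y"
proof -
  obtain h where h: "h x = 1" "h y = 0" and off: "\<And>v. v \<in> verts H - {x, y} \<Longrightarrow> net_outflow H r h v = 0"
    using ex_harmonic_off[OF assms(4)] by blast
  have two: "(\<Sum>v\<in>verts H. f v * net_outflow H r h v) = f x * net_outflow H r h x + f y * net_outflow H r h y" for f
  proof -
    have "(\<Sum>v\<in>verts H. f v * net_outflow H r h v) = (\<Sum>v\<in>{x, y}. f v * net_outflow H r h v)"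
      using fin assms off by (intro sum.mono_neutral_right) (auto simp: finite_graph_def)
    then show ?thesis using assms(4) by simp
  qed
  \<comment> \<open>Pairing with a constant shows that the net outflows sum to zero, so what leaves
    \<open>x\<close> arrives at \<open>y\<close>.\<close>
  have "dirichlet H r (\<lambda>_. 1) h = 0" unfolding dirichlet_def by simp
  then have y: "net_outflow H r h y = - net_outflow H r h x" unfolding dirichlet_eq two by simp
  \<comment> \<open>Zero energy would force \<open>h x = h y\<close>. Hence the flow out of
    \<open>x\<close> is nonzero and can be normalised to 1.\<close>
  have "dirichlet H r h h \<noteq> 0" using constant_if_dirichlet_zero[of h x y, OF assms(1) _ assms(2,3)] h by auto
  then have "net_outflow H r h x \<noteq> 0" unfolding dirichlet_eq two h by simp
  then have "induces_unit_flow H r (\<lambda>v. h v / net_outflow H r h x) x y"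
    unfolding induces_unit_flow_def net_outflow_scale using off y by simp
  then show ?thesis by blast
qed

text \<open>The difference of two potentials of unit flows has no net outflow anywhere, hence zero
  energy, and is constant. This justifies the definite description.\<close>

lemma eff_resistance_eq:
  assumes "connected_graph H" "x \<in> verts H" "y \<in> verts H" "x \<noteq> y" "induces_unit_flow H r p x y"
  shows "eff_resistance H r x y = p x - p y"
proof -
  have "q x - q y = p x - p y" if q: "induces_unit_flow H r q x y" for q
  proof -
    have "dirichlet H r (\<lambda>v. q v - p v) (\<lambda>v. q v - p v) = 0"
      using q assms(5) unfolding dirichlet_eq net_outflow_diff induces_unit_flow_def by simp
    from constant_if_dirichlet_zero[OF assms(1) this assms(2,3)] show ?thesis by linarith
  qed
  then have "(THE \<rho>. \<exists>h. induces_unit_flow H r h x y \<and> \<rho> = h x - h y) = p x - p y"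
    using assms(5) by (intro the_equality) blast+
  then show ?thesis using assms(4) unfolding eff_resistance_def by simp
qed

text \<open>Pairing \<open>h\<close> with a unit-flow potential \<open>p\<close> gives twice
  \<open>h x - h y\<close>, and pairing \<open>p\<close> with itself gives twice the resistance;
  Cauchy-Schwarz then yields the bound.\<close>

lemma potential_difference_bound:
  assumes "connected_graph H" "x \<in> verts H" "y \<in> verts H"
  shows "(h x - h y)\<^sup>2 \<le> eff_resistance H r x y * (\<Sum>e\<in>edges H. edge_energy H r h e)"
proof (cases "x = y")
  case False
  obtain p where p: "induces_unit_flow H r p x y" using ex_unit_flow assms False by blast
  have dp: "dirichlet H r f p = 2 * (f x - f y)" for f
  proof -
    have "(\<Sum>v\<in>verts H. f v * net_outflow H r p v) = (\<Sum>v\<in>{x, y}. f v * (if v = x then 1 else - 1))"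
      using p fin assms unfolding induces_unit_flow_def finite_graph_def
      by (intro sum.mono_neutral_cong_right) auto
    then show ?thesis unfolding dirichlet_eq using False by simp
  qed
  have R: "eff_resistance H r x y = p x - p y"
    using eff_resistance_eq assms False p by blast
  then have "eff_resistance H r x y \<ge> 0" using dirichlet_nonneg[of p] unfolding dp by simp
  then have "dirichlet H r h h * (2 * eff_resistance H r x y) \<le>
      2 * (\<Sum>e\<in>edges H. edge_energy H r h e) * (2 * eff_resistance H r x y)"
    by (intro mult_right_mono dirichlet_le_energy) simp
  moreover have "4 * (h x - h y)\<^sup>2 \<le> dirichlet H r h h * (2 * eff_resistance H r x y)"
    using dirichlet_Cauchy_Schwarz[of h p] unfolding dp R power_mult_distrib by simp
  ultimately show ?thesis by (simp add: mult.commute)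
qed (simp add: eff_resistance_def)

end

section \<open>Barricades\<close>

text \<open>The component containing the end \<open>a\<close> also contains \<open>e\<close>, and no
  other component does, since components share no edge.\<close>

lemma barricaded_area_eq:
  assumes "wf_graph G" "barricade G S e" "ends G e = {a, b}"
  defines "A \<equiv> barricaded_area G S e"
  shows "A \<in> components_of (delete_verts G S)" "a \<in> verts A" "b \<in> verts A"
proof -
  let ?H = "delete_verts G S"
  have e: "e \<in> edges ?H" using assms unfolding barricade_def by blast
  have wf: "wf_graph ?H" unfolding delete_verts_def by (intro wf_induced assms)
  have ends: "ends ?H e = {a, b}" using assms by (simp add: delete_verts_def induced_def)
  have ab: "a \<in> verts ?H" "b \<in> verts ?H" using wf_graphD[OF wf e ends] by auto
  have adj: "adjacent ?H a b" using e ends unfolding adjacent_def by blast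
  define K where "K = induced ?H {w. (adjacent ?H)\<^sup>*\<^sup>* a w}"
  have K: "K \<in> components_of ?H" unfolding K_def components_of_def using ab by blast
  have eK: "e \<in> edges K" using e ends adj unfolding K_def induced_def by auto
  have "A = K" unfolding A_def barricaded_area_def
    by (rule the_equality) (use K eK component_edges_disjoint[OF wf] in blast)+
  then show "A \<in> components_of ?H" "a \<in> verts A" "b \<in> verts A"
    using K ab adj by (auto simp: K_def induced_def)
qed

text \<open>A neighbour of the area outside \<open>S\<close> would belong to the same component of
  \<open>G - S\<close>, that is, to the area itself.\<close>

lemma boundary_subset:
  assumes "wf_graph G" "barricade G S e"
  shows "barricade_boundary G S e \<subseteq> verts S"
proof
  fix u assume u: "u \<in> barricade_boundary G S e"
  let ?H = "delete_verts G S"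
  define A where "A = barricaded_area G S e"
  obtain a b where ab: "ends G e = {a, b}"
    using assms unfolding barricade_def wf_graph_def delete_verts_def induced_def by fastforce
  have A: "A \<in> components_of ?H" unfolding A_def using barricaded_area_eq(1)[OF assms ab] .
  obtain w where w: "u \<in> verts G" "u \<notin> verts A" "w \<in> verts A" "adjacent G u w"
    using u unfolding barricade_boundary_def A_def by auto
  have wH: "w \<in> verts ?H" using w(3) component_subgraph(1)[OF A] by auto
  show "u \<in> verts S"
  proof (rule ccontr)
    assume uS: "u \<notin> verts S"
    then have uH: "u \<in> verts ?H" using w(1) by (auto simp: delete_verts_def induced_def)
    have "adjacent ?H w u"
      using wH uS w unfolding delete_verts_def adjacent_induced
      by (auto simp: induced_def adjacent_commute[of G u w])
    then have "u \<in> verts A"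
      by (subst component_eq[OF A w(3)]) (use uH in \<open>auto simp: induced_def\<close>)
    with w(2) show False ..
  qed
qed

text \<open>This is where the second barricade condition enters: \<open>u\<close> and
  \<open>v\<close> lie in one component of the complement of the area, and \<open>S\<close> meets
  that component in a connected graph.\<close>

lemma boundary_reachable:
  assumes "wf_graph G" "barricade G S e"
    and u: "u \<in> barricade_boundary G S e" and v: "v \<in> barricade_boundary G S e"
    and uv: "(adjacent (delete_verts G (barricaded_area G S e)))\<^sup>*\<^sup>* u v"
  shows "(adjacent S)\<^sup>*\<^sup>* u v"
proof -
  let ?H = "delete_verts G (barricaded_area G S e)"
  have uvS: "u \<in> verts S" "v \<in> verts S" using u v boundary_subset[OF assms(1,2)] by auto
  have uvH: "u \<in> verts ?H" "v \<in> verts ?H"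
    using u v by (auto simp: barricade_boundary_def delete_verts_def induced_def)
  define D where "D = induced ?H {w. (adjacent ?H)\<^sup>*\<^sup>* u w}"
  have "D \<in> components_of ?H" unfolding D_def components_of_def using uvH by blast
  then have "connected_graph (graph_inter S D)" using assms(2) unfolding barricade_def by blast
  moreover have "u \<in> verts (graph_inter S D)" "v \<in> verts (graph_inter S D)"
    using uvS uvH uv by (auto simp: graph_inter_def D_def induced_def)
  ultimately have "(adjacent (graph_inter S D))\<^sup>*\<^sup>* u v" unfolding connected_graph_def by blast
  moreover have "adjacent (graph_inter S D) \<le> adjacent S"
    unfolding adjacent_def graph_inter_def by (simp add: le_fun_def) blast
  ultimately show ?thesis using rtranclp_mono by blast
qed

text \<open>Subadditivity of Lebesgue measure. Only the open interval has to be covered, so an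
  uncovered level lies strictly between \<open>b\<close> and \<open>a\<close>.\<close>

lemma interval_cover_length:
  fixes l u :: "'a \<Rightarrow> real"
  assumes "finite F" "\<And>C. C \<in> F \<Longrightarrow> l C \<le> u C" "{b<..<a} \<subseteq> (\<Union>C\<in>F. {l C..u C})" "b \<le> a"
  shows "a - b \<le> (\<Sum>C\<in>F. u C - l C)"
proof -
  have "ennreal (a - b) = emeasure lborel {b<..<a}" using assms(4) by simp
  also have "\<dots> \<le> emeasure lborel (\<Union>C\<in>F. {l C..u C})"
    using assms(1) by (intro emeasure_mono assms(3)) auto
  also have "\<dots> \<le> (\<Sum>C\<in>F. emeasure lborel {l C..u C})"
    using assms(1) by (intro emeasure_subadditive_finite) auto
  also have "\<dots> = ennreal (\<Sum>C\<in>F. u C - l C)"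
    using assms(2) by (subst sum_ennreal[symmetric]) auto
  finally show ?thesis using assms(2) by (simp add: ennreal_le_iff sum_nonneg)
qed

text \<open>If the ranges of \<open>h\<close> on the boundaries of the components of \<open>S\<close> miss a level \<open>t\<close>
  strictly between the values at the ends of \<open>e\<close>, then, by connectedness of \<open>S\<close> in every component
  of the complement of the area, \<open>t\<close> determines a finite cut that is crossed downhill by every edge,
  and \<open>e\<close> crosses it.\<close>

lemma drop_le_boundary_oscillation:
  assumes net: "network G r" and lf: "locally_finite_graph G" and bar: "barricade G S e"
    and ne: "non_elusive G r h" and ab: "ends G e = {a, b}" and lt: "h b < h a"
    and nonneg: "\<And>C. C \<in> components_of S \<Longrightarrow> 0 \<le> q C"
    and osc: "\<And>C u v. C \<in> components_of S \<Longrightarrow> u \<in> barricade_boundary G S e \<inter> verts C \<Longrightarrow>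
                v \<in> barricade_boundary G S e \<inter> verts C \<Longrightarrow> h u - h v \<le> q C"
  shows "h a - h b \<le> (\<Sum>C\<in>components_of S. q C)"
proof (rule ccontr)
  define B where "B = barricade_boundary G S e"
  define A where "A = verts (barricaded_area G S e)"
  let ?H = "delete_verts G (barricaded_area G S e)"
  assume less: "\<not> ?thesis"
  have wf: "wf_graph G" using net unfolding network_def by blast
  have finS: "finite (verts S)" using bar unfolding barricade_def finite_graph_def by blast
  have finA: "finite A" using bar unfolding barricade_def finite_graph_def A_def by blast
  have BS: "B \<subseteq> verts S" unfolding B_def by (rule boundary_subset[OF wf bar])
  have finB: "finite B" using finite_subset[OF BS finS] .
  have finC: "finite (components_of S)" unfolding components_of_def using finS by simp
  have abA: "a \<in> A" "b \<in> A" unfolding A_def using barricaded_area_eq[OF wf bar ab] by auto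
  have AG: "A \<subseteq> verts G"
    using component_subgraph(1)[OF barricaded_area_eq(1)[OF wf bar ab]]
    unfolding A_def by (auto simp: delete_verts_def induced_def)
  have "\<exists>l u. l \<le> u \<and> u - l \<le> q C \<and> h ` (B \<inter> verts C) \<subseteq> {l..u}" if C: "C \<in> components_of S" for C
  proof (cases "B \<inter> verts C = {}")
    \<comment> \<open>A component that misses the boundary imposes no constraint and receives the
      interval from 0 to 0.\<close>
    case True
    then show ?thesis using nonneg[OF C] by (intro exI[of _ 0]) auto
  next
    case False
    let ?M = "h ` (B \<inter> verts C)"
    have M: "finite ?M" "?M \<noteq> {}" using finB False by auto
    have "Max ?M \<in> ?M" "Min ?M \<in> ?M" using Max_in[OF M] Min_in[OF M] by auto
    then have "Max ?M - Min ?M \<le> q C" using osc[OF C] unfolding B_def[symmetric] by force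
    moreover have "Min ?M \<le> Max ?M" using \<open>Max ?M \<in> ?M\<close> M Min_le by blast
    moreover have "?M \<subseteq> {Min ?M..Max ?M}" using M by auto
    ultimately show ?thesis by blast
  qed
  then obtain l u where lu: "\<And>C. C \<in> components_of S \<Longrightarrow> l C \<le> u C"
    "\<And>C. C \<in> components_of S \<Longrightarrow> u C - l C \<le> q C"
    "\<And>C. C \<in> components_of S \<Longrightarrow> h ` (B \<inter> verts C) \<subseteq> {l C..u C}" by metis
  have "\<not> {h b<..<h a} \<subseteq> (\<Union>C\<in>components_of S. {l C..u C})"
  proof
    assume "{h b<..<h a} \<subseteq> (\<Union>C\<in>components_of S. {l C..u C})"
    then have "h a - h b \<le> (\<Sum>C\<in>components_of S. u C - l C)"
      using interval_cover_length[OF finC] lu(1) lt by auto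
    also have "\<dots> \<le> (\<Sum>C\<in>components_of S. q C)" by (intro sum_mono lu)
    finally show False using less by simp
  qed
  then obtain t where t: "h b < t" "t < h a" and avoid: "\<And>C. C \<in> components_of S \<Longrightarrow> t \<notin> {l C..u C}"
    by (auto simp: subset_iff)
  \<comment> \<open>Both vertices lie in one component of \<open>S\<close>, whose interval contains
    both values but not \<open>t\<close>.\<close>
  have same_side: "h v > t" if v: "v \<in> B" and w: "w \<in> B" "h w > t" and vw: "(adjacent ?H)\<^sup>*\<^sup>* v w" for v w
  proof -
    have vwS: "(adjacent S)\<^sup>*\<^sup>* v w"
      using boundary_reachable[OF wf bar] v w vw unfolding B_def by blast
    define C where "C = induced S {z. (adjacent S)\<^sup>*\<^sup>* v z}"
    have C: "C \<in> components_of S" unfolding C_def components_of_def using v BS by blast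
    have "v \<in> B \<inter> verts C" "w \<in> B \<inter> verts C"
      using v w BS vwS by (auto simp: C_def induced_def)
    then have "h v \<in> {l C..u C}" "h w \<in> {l C..u C}" using lu(3)[OF C] by blast+
    then show ?thesis using avoid[OF C] w(2) by auto
  qed
  \<comment> \<open>Inside the area \<open>X\<close> is a superlevel set; outside it consists of the
    whole components that contain a boundary vertex above level \<open>t\<close>.\<close>
  define X where "X = {v \<in> A. h v > t} \<union> {v \<in> verts G - A. \<exists>w\<in>B. h w > t \<and> (adjacent ?H)\<^sup>*\<^sup>* v w}"
  have B: "v \<in> B" if "v \<in> verts G - A" "w \<in> A" "adjacent G v w" for v w
    using that unfolding B_def A_def barricade_boundary_def by blast
  have cut: "(v \<in> A \<or> w \<in> A) \<and> h w < h v"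
    if v: "v \<in> X" and w: "w \<in> verts G - X" and adj: "adjacent G v w" for v w
  proof -
    have adj': "adjacent G w v" using adj adjacent_commute by metis
    consider "v \<in> A" "w \<in> A" | "v \<in> A" "w \<notin> A" | "v \<notin> A" "w \<in> A" | "v \<notin> A" "w \<notin> A" by blast
    then show ?thesis
    proof cases
      case 1
      then show ?thesis using v w unfolding X_def by auto
    next
      case 2
      then have "w \<in> B" using B[of w v] w adj' by blast
      then have "\<not> h w > t" using w 2 unfolding X_def by blast
      then show ?thesis using v 2 unfolding X_def by auto
    next
      case 3
      then have "v \<in> B" using B[of v w] v adj unfolding X_def by auto
      then have "h v > t" using v 3 same_side unfolding X_def by blast
      then show ?thesis using w 3 unfolding X_def by auto
    next
      \<comment> \<open>Outside the area \<open>X\<close> is a union of components, so no edge there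
        can leave it.\<close>
      case 4
      then have "adjacent ?H w v"
        using v w adj' unfolding delete_verts_def adjacent_induced X_def A_def[symmetric] by auto
      then have "w \<in> X" using v w 4 unfolding X_def by (auto intro: converse_rtranclp_into_rtranclp)
      then show ?thesis using w by blast
    qed
  qed
  \<comment> \<open>Every cut edge meets the area, and only finitely many edges do, by local
    finiteness.\<close>
  define Z where "Z = (\<Union>v\<in>A. {e \<in> edges G. v \<in> ends G e})"
  have finZ: "finite Z" unfolding Z_def using finA lf AG unfolding locally_finite_graph_def by blast
  have crossZ: "e \<in> Z" if "e \<in> edges G" "ends G e = {v, w}" "v \<in> X" "w \<in> verts G - X" for e v w
  proof -
    have "adjacent G v w" using that unfolding adjacent_def by blast
    with cut[OF that(3,4)] that show ?thesis unfolding Z_def by auto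
  qed
  have XG: "X \<subseteq> verts G" unfolding X_def using AG by auto
  have "{e \<in> edges G. \<exists>v\<in>X. \<exists>w\<in>verts G - X. ends G e = {v, w}} \<subseteq> Z" using crossZ by blast
  then have "finite {e \<in> edges G. \<exists>v\<in>X. \<exists>w\<in>verts G - X. ends G e = {v, w}}"
    using finZ finite_subset by blast
  then have flow0: "flow_between G r h X (verts G - X) = 0"
    by (intro ne[unfolded non_elusive_def, rule_format] conjI) (use XG in auto)
  let ?E = "directed_edges_between G X (verts G - X)"
  have "finite (\<Union>e\<in>Z. ends G e)"
    using finZ wf unfolding wf_graph_def Z_def by fastforce
  moreover have "?E \<subseteq> (\<Union>e\<in>Z. ends G e) \<times> Z \<times> (\<Union>e\<in>Z. ends G e)"
    using crossZ unfolding directed_edges_between_def by fast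
  ultimately have finE: "finite ?E" using finZ by (meson finite_SigmaI finite_subset)
  have eG: "e \<in> edges G" using bar unfolding barricade_def delete_verts_def induced_def by simp
  have "(a, e, b) \<in> ?E"
    using eG ab abA AG t unfolding directed_edges_between_def X_def by auto
  moreover have "(h v - h w) / r e > 0" if "(v, e, w) \<in> ?E" for v e w
  proof -
    have "adjacent G v w" "v \<in> X" "w \<in> verts G - X" "r e > 0"
      using that net unfolding directed_edges_between_def adjacent_def network_def by auto
    then show ?thesis using cut by simp
  qed
  ultimately have "flow_between G r h X (verts G - X) > 0"
    unfolding flow_between_def by (intro sum_pos finE) auto
  with flow0 show False by simp
qed

section \<open>Energy of a potential on disjoint barricades\<close>

lemma barricade_energy_bound:
  assumes net: "network G r" and lf: "locally_finite_graph G" and bar: "barricade G S e"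
    and ne: "non_elusive G r h" and ab: "ends G e = {a, b}" and lt: "h b < h a"
  shows "ennreal ((h a - h b)\<^sup>2) * (1 / wRD G r S e) \<le> ennreal (\<Sum>e\<in>edges S. edge_energy G r h e)"
\<comment> \<open>If \<open>wRD\<close> is infinite, its reciprocal is 0 and the bound is trivial;
  otherwise every summand is finite and can be treated as a real number.\<close>
proof (cases "wRD G r S e = \<infinity>")
  case False
  define B where "B = barricade_boundary G S e"
  define E where "E C = (\<Sum>e\<in>edges C. edge_energy G r h e)" for C :: "('a, 'b) multigraph"
  define W where "W C = wRD_component C r (B \<inter> verts C)" for C
  define q where "q C = enn2real (W C)" for C
  have sub: "subgraph_of S G" and finS: "finite_graph S" using bar unfolding barricade_def by auto
  have netS: "network S r" using sub net unfolding network_def subgraph_of_def by auto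
  then have wfS: "wf_graph S" unfolding network_def by blast
  have finC: "finite (components_of S)" using finS unfolding components_of_def finite_graph_def by simp
  have wRD: "wRD G r S e = (\<Sum>C\<in>components_of S. W C)" unfolding wRD_def W_def B_def ..
  have W: "W C = ennreal (q C)" if "C \<in> components_of S" for C
    using False that finC unfolding wRD q_def by (simp add: less_top)
  have E0: "E C \<ge> 0" if "C \<in> components_of S" for C
    unfolding E_def using edge_energy_nonneg[OF net] component_subgraph(2)[OF that] sub
    by (intro sum_nonneg) (auto simp: subgraph_of_def)
  have osc: "h u - h v \<le> sqrt (q C * E C)"
    if C: "C \<in> components_of S" and u: "u \<in> B \<inter> verts C" and v: "v \<in> B \<inter> verts C" for C u v
  proof -
    have "network C r"
      using netS wf_component[OF wfS C] component_subgraph[OF C] unfolding network_def by auto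
    then interpret finite_network C r
      using finite_component[OF finS C] by unfold_locales
    have ends: "ends C = ends G" using component_subgraph(3)[OF C] sub unfolding subgraph_of_def by simp
    have "ennreal (eff_resistance C r u v) \<le> ennreal (q C)"
      unfolding W[OF C, symmetric] W_def wRD_component_def using u v by (intro Sup_upper) blast
    then have "eff_resistance C r u v \<le> q C" by (simp add: ennreal_le_iff q_def)
    have "(h u - h v)\<^sup>2 \<le> eff_resistance C r u v * (\<Sum>e\<in>edges C. edge_energy C r h e)"
      using potential_difference_bound[OF connected_component[OF C]] u v by blast
    also have "(\<Sum>e\<in>edges C. edge_energy C r h e) = E C"
      unfolding E_def edge_energy_def ends ..
    also have "eff_resistance C r u v * E C \<le> q C * E C"
      using \<open>eff_resistance C r u v \<le> q C\<close> E0[OF C] by (rule mult_right_mono)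
    finally show ?thesis by (rule real_le_rsqrt)
  qed
  have "h a - h b \<le> (\<Sum>C\<in>components_of S. sqrt (q C * E C))"
    using osc E0 unfolding B_def
    by (intro drop_le_boundary_oscillation[OF net lf bar ne ab lt]) (auto simp: q_def)
  then have "(h a - h b)\<^sup>2 \<le> (\<Sum>C\<in>components_of S. sqrt (q C) * sqrt (E C))\<^sup>2"
    using lt by (intro power_mono) (auto simp: real_sqrt_mult)
  also have "\<dots> \<le> (\<Sum>C\<in>components_of S. (sqrt (q C))\<^sup>2) * (\<Sum>C\<in>components_of S. (sqrt (E C))\<^sup>2)"
    by (rule Cauchy_Schwarz_ineq_sum)
  also have "\<dots> = (\<Sum>C\<in>components_of S. q C) * (\<Sum>C\<in>components_of S. E C)"
    using E0 by (simp add: q_def)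
  \<comment> \<open>The components are edge-disjoint, so their energies sum to the energy on a
    subset of \<open>edges S\<close>.\<close>
  also have "(\<Sum>C\<in>components_of S. E C) = (\<Sum>e\<in>(\<Union>C\<in>components_of S. edges C). edge_energy G r h e)"
    unfolding E_def using finC finite_component[OF finS] component_edges_disjoint[OF wfS]
    by (intro sum.UNION_disjoint[symmetric]) (auto simp: finite_graph_def)
  also have "(\<Sum>C\<in>components_of S. q C) * \<dots> \<le> (\<Sum>C\<in>components_of S. q C) * E S"
    unfolding E_def using finS component_subgraph(2)[of _ S] edge_energy_nonneg[OF net] sub
    by (intro mult_left_mono sum_mono2 sum_nonneg) (auto simp: finite_graph_def q_def subgraph_of_def)
  finally have main: "(h a - h b)\<^sup>2 \<le> (\<Sum>C\<in>components_of S. q C) * E S" .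
  have wq: "wRD G r S e = ennreal (\<Sum>C\<in>components_of S. q C)"
    unfolding wRD using W by (subst sum_ennreal[symmetric]) (auto simp: q_def)
  have "(\<Sum>C\<in>components_of S. q C) \<ge> 0" by (intro sum_nonneg) (simp add: q_def)
  \<comment> \<open>A zero sum would make the drop vanish by \<open>main\<close>. So
    \<open>wRD\<close> is positive and the convention for \<open>1 / 0\<close> does not
    interfere.\<close>
  moreover have "(\<Sum>C\<in>components_of S. q C) \<noteq> 0" using main lt by auto
  ultimately have Q: "(\<Sum>C\<in>components_of S. q C) > 0" by simp
  then have "ennreal ((h a - h b)\<^sup>2) * (1 / wRD G r S e) =
      ennreal ((h a - h b)\<^sup>2 / (\<Sum>C\<in>components_of S. q C))"
    unfolding wq by (simp add: divide_ennreal[symmetric] divide_ennreal_def)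
  also have "\<dots> \<le> ennreal (E S)"
    using main Q by (intro ennreal_leI) (simp add: field_simps)
  finally show ?thesis unfolding E_def .
qed (simp add: ennreal_divide_top)

text \<open>Each partial sum is a sum over one finite set of edges by disjointness, and the energy
  is the supremum of such finite sums.\<close>

lemma suminf_barricade_energy_le:
  assumes net: "network G r" and sub: "\<And>n. edges (S n) \<subseteq> edges G" and fin: "\<And>n. finite (edges (S n))"
    and dis: "disjoint_family (\<lambda>n. edges (S n))"
  shows "(\<Sum>n. ennreal (\<Sum>e\<in>edges (S n). edge_energy G r h e)) \<le> energy G r h"
proof (rule suminf_le_const)
  fix N :: nat
  have nn: "edge_energy G r h e \<ge> 0" if "e \<in> edges (S n)" for e n
    using that sub edge_energy_nonneg[OF net] by blast
  have "(\<Sum>n<N. ennreal (\<Sum>e\<in>edges (S n). edge_energy G r h e)) =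
      (\<Sum>n<N. \<Sum>e\<in>edges (S n). ennreal (edge_energy G r h e))"
    using nn by (intro sum.cong refl sum_ennreal[symmetric])
  also have "\<dots> = (\<Sum>e\<in>(\<Union>n<N. edges (S n)). ennreal (edge_energy G r h e))"
    using fin dis by (intro sum.UNION_disjoint[symmetric]) (auto simp: disjoint_family_on_def)
  also have "\<dots> \<le> energy G r h"
    unfolding energy_def using fin sub
    by (subst nonneg_infsum_complete) (auto intro!: SUP_upper)
  finally show "(\<Sum>n<N. ennreal (\<Sum>e\<in>edges (S n). edge_energy G r h e)) \<le> energy G r h" .
qed simp

theorem theorem5p1:
  fixes G :: "('v, 'e) multigraph" and r :: "'e \<Rightarrow> real"
  assumes "network G r"
    and "connected_graph G"
    and "locally_finite_graph G"
    and "\<forall>e\<in>edges G. \<exists>S :: nat \<Rightarrow> ('v, 'e) multigraph.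
           inj S \<and> (\<forall>n. barricade G (S n) e) \<and> disjoint_family (\<lambda>n. edges (S n)) \<and>
           (\<Sum>n. 1 / wRD G r (S n) e) = \<infinity>"
  shows "\<forall>h :: 'v \<Rightarrow> real. harmonic G r h \<and> non_elusive G r h \<and> energy G r h < \<infinity> \<longrightarrow>
           (\<exists>c. \<forall>v\<in>verts G. h v = c)"
proof (intro allI impI)
  fix h :: "'v \<Rightarrow> real"
  assume h: "harmonic G r h \<and> non_elusive G r h \<and> energy G r h < \<infinity>"
  \<comment> \<open>Adjacency is symmetric, so excluding drops in both directions makes
    \<open>h\<close> constant along edges.\<close>
  have no_drop: "\<not> h b < h a" if adj: "adjacent G a b" for a b
  proof
    assume lt: "h b < h a"
    obtain e where e: "e \<in> edges G" "ends G e = {a, b}" using adj unfolding adjacent_def by auto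
    obtain S :: "nat \<Rightarrow> ('v, 'e) multigraph" where S: "\<And>n. barricade G (S n) e"
      "disjoint_family (\<lambda>n. edges (S n))" "(\<Sum>n. 1 / wRD G r (S n) e) = \<infinity>"
      using assms(4) e(1) by blast
    \<comment> \<open>The squared drop is nonzero, so its product with the divergent series is still
      infinite.\<close>
    have "\<infinity> = ennreal ((h a - h b)\<^sup>2) * (\<Sum>n. 1 / wRD G r (S n) e)"
      using lt unfolding S(3) by (simp add: ennreal_mult_top)
    also have "\<dots> = (\<Sum>n. ennreal ((h a - h b)\<^sup>2) * (1 / wRD G r (S n) e))" by simp
    also have "\<dots> \<le> (\<Sum>n. ennreal (\<Sum>e\<in>edges (S n). edge_energy G r h e))"
      using barricade_energy_bound[OF assms(1,3) S(1) _ e(2) lt] h by (intro suminf_le) auto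
    also have "\<dots> \<le> energy G r h"
      using S(1,2) unfolding barricade_def subgraph_of_def finite_graph_def
      by (intro suminf_barricade_energy_le[OF assms(1)]) auto
    finally show False using h by (simp add: top_unique)
  qed
  obtain v where v: "v \<in> verts G" using assms(2) unfolding connected_graph_def by auto
  have "h w = h v" if "w \<in> verts G" for w
  proof -
    have "(adjacent G)\<^sup>*\<^sup>* v w" using assms(2) v that unfolding connected_graph_def by blast
    then show ?thesis
    proof (induction rule: rtranclp_induct)
      case (step y z)
      then show ?case using no_drop[of y z] no_drop[of z y] adjacent_commute[of G y z] by auto
    qed simp
  qed
  then show "\<exists>c. \<forall>v\<in>verts G. h v = c" by blast
qed

end
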